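(* Let $T$ be an operator from a locally solid lattice $(X,\varsigma)$ to a topological vector space $(Y,\tau)$. Then $T$ is quasi $KB$ if and only if $T$ is quasi $\sigma$-$KB$.
   Context: All vector spaces are real, operators are linear (not assumed continuous), vector topologies are Hausdorff, vector lattices are Archimedean. A locally solid lattice is a vector lattice with a linear topology having a base at zero of solid sets. An operator $T:(X,\varsigma)\to(Y,\tau)$ is called quasi $KB$ (respectively quasi $\sigma$-$KB$) if $T$ takes every $\varsigma$-bounded increasing net (respectively sequence) in $X_+$ to a $\tau$-Cauchy net (respectively sequence). *)

theory Defs
  imports "HOL-Analysis.Analysis" "HOL-Library.Lattice_Algebras"
begin

text \<open>All vector topologies are Hausdorff by convention, hence \<^class>\<open>t2_space\<close>.\<close>

class topological_vector_space = real_vector + topological_ab_group_add + t2_space +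
  assumes tendsto_scaleR_Pair:
    "filterlim (\<lambda>p. fst p *\<^sub>R snd p) (nhds (c *\<^sub>R a)) (nhds c \<times>\<^sub>F nhds a)"

text \<open>
  Vector lattices are Archimedean by convention.  The absolute value is the lattice one,
  \<open>\<bar>x\<bar> = sup x (- x)\<close>, by \<^class>\<open>lattice_ab_group_add_abs\<close>.
\<close>

class vector_lattice = ordered_real_vector + lattice_ab_group_add_abs +
  assumes archimedean: "0 \<le> x \<Longrightarrow> (\<And>n::nat. real n *\<^sub>R x \<le> y) \<Longrightarrow> x = 0"

definition (in vector_lattice) solid :: "'a set \<Rightarrow> bool" where
  "solid S \<longleftrightarrow> (\<forall>x y. y \<in> S \<and> \<bar>x\<bar> \<le> \<bar>y\<bar> \<longrightarrow> x \<in> S)"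

text \<open>The solid neighbourhoods of zero forming the base need not be open.\<close>

class locally_solid_lattice = vector_lattice + topological_vector_space +
  assumes solid_base_at_zero:
    "open U \<Longrightarrow> 0 \<in> U \<Longrightarrow>
      \<exists>V W. open W \<and> 0 \<in> W \<and> W \<subseteq> V \<and> V \<subseteq> U \<and> solid V"

definition tvs_bounded :: "'a::topological_vector_space set \<Rightarrow> bool" where
  "tvs_bounded A \<longleftrightarrow> (\<forall>U. open U \<and> 0 \<in> U \<longrightarrow> (\<exists>c>0. A \<subseteq> (\<lambda>u. c *\<^sub>R u) ` U))"

text \<open>
  A net is a function \<open>x\<close> together with an index set \<open>I\<close> directed by a preorder \<open>r\<close>, where
  \<open>(i, j) \<in> r\<close> means that \<open>i\<close> precedes \<open>j\<close>; only the values of \<open>x\<close> on \<open>I\<close> matter.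
\<close>

definition directed_set :: "'i set \<Rightarrow> ('i \<times> 'i) set \<Rightarrow> bool" where
  "directed_set I r \<longleftrightarrow> I \<noteq> {} \<and> preorder_on I r \<and>
     (\<forall>i\<in>I. \<forall>j\<in>I. \<exists>k\<in>I. (i, k) \<in> r \<and> (j, k) \<in> r)"

definition increasing_net :: "'i set \<Rightarrow> ('i \<times> 'i) set \<Rightarrow> ('i \<Rightarrow> 'a::order) \<Rightarrow> bool" where
  "increasing_net I r x \<longleftrightarrow> monotone_on I (\<lambda>i j. (i, j) \<in> r) (\<le>) x"

definition Cauchy_net ::
  "'i set \<Rightarrow> ('i \<times> 'i) set \<Rightarrow> ('i \<Rightarrow> 'b::topological_vector_space) \<Rightarrow> bool" where
  "Cauchy_net I r y \<longleftrightarrow> (\<forall>U. open U \<and> 0 \<in> U \<longrightarrow>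
     (\<exists>k\<in>I. \<forall>i\<in>I. \<forall>j\<in>I. (k, i) \<in> r \<and> (k, j) \<in> r \<longrightarrow> y i - y j \<in> U))"

definition Cauchy_seq :: "(nat \<Rightarrow> 'b::topological_vector_space) \<Rightarrow> bool" where
  "Cauchy_seq y \<longleftrightarrow> (\<forall>U. open U \<and> 0 \<in> U \<longrightarrow> (\<exists>N. \<forall>m\<ge>N. \<forall>n\<ge>N. y m - y n \<in> U))"

text \<open>
  HOL cannot quantify over all types inside a definition, so the type \<open>'i\<close> supplying the index
  sets is a parameter: the index sets of the nets are arbitrary subsets of \<open>'i\<close>.  A statement
  about \<open>quasi_KB TYPE('i)\<close> for a type variable \<open>'i\<close> covers nets of every size.  The type
  \<open>'i\<close> must be infinite for sequences to be among the nets considered.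
\<close>

definition quasi_KB ::
  "'i itself \<Rightarrow> ('a::locally_solid_lattice \<Rightarrow> 'b::topological_vector_space) \<Rightarrow> bool" where
  "quasi_KB (_ :: 'i itself) T \<longleftrightarrow> (\<forall>(I :: 'i set) r x.
     directed_set I r \<and> increasing_net I r x \<and> (\<forall>i\<in>I. 0 \<le> x i) \<and> tvs_bounded (x ` I)
     \<longrightarrow> Cauchy_net I r (\<lambda>i. T (x i)))"

definition quasi_sigma_KB ::
  "('a::locally_solid_lattice \<Rightarrow> 'b::topological_vector_space) \<Rightarrow> bool" where
  "quasi_sigma_KB T \<longleftrightarrow> (\<forall>x :: nat \<Rightarrow> 'a.
     incseq x \<and> (\<forall>n. 0 \<le> x n) \<and> tvs_bounded (range x) \<longrightarrow> Cauchy_seq (\<lambda>n. T (x n)))"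

end

theory Submission
  imports Defs
begin

text \<open>
  Sequences are nets indexed by a copy of the natural numbers inside the infinite index type, so
  the quasi KB property restricts to sequences.  Conversely, if some bounded increasing net has a
  non-Cauchy image, then a fixed neighbourhood \<open>V\<close> of zero exists such that from every index one
  can move to a later index whose image differs from the current one by a vector outside \<open>V\<close>
  (lemma \<open>not_Cauchy_net_jumps\<close>).  Iterating such jumps yields a sequence whose consecutive images
  stay \<open>V\<close>-apart, while its terms still form an increasing positive sequence inside the same
  bounded set; this contradicts the quasi \<open>\<sigma>\<close>-KB property.
\<close>

lemma tvs_bounded_subset:
  assumes "tvs_bounded B" and "A \<subseteq> B"
  shows "tvs_bounded A"
  using assms unfolding tvs_bounded_def by (meson subset_trans)

lemma zero_neighbourhood_diff:
  fixes U :: "'b::topological_group_add set"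
  assumes "open U" and "0 \<in> U"
  obtains V where "open V" and "0 \<in> V" and "\<And>u v. u \<in> V \<Longrightarrow> v \<in> V \<Longrightarrow> u - v \<in> U"
proof -
  let ?d = "\<lambda>p::'b \<times> 'b. fst p - snd p"
  have "continuous_on UNIV ?d"
    by (intro continuous_intros)
  then have "open (?d -` U)"
    using \<open>open U\<close> by (simp add: open_vimage)
  moreover have "(0, 0) \<in> ?d -` U"
    using \<open>0 \<in> U\<close> by simp
  ultimately obtain A B where AB: "open A" "open B" "(0, 0) \<in> A \<times> B" "A \<times> B \<subseteq> ?d -` U"
    by (rule open_prod_elim)
  show thesis
  proof (rule that)
    show "open (A \<inter> B)"
      using AB by (simp add: open_Int)
    show "0 \<in> A \<inter> B"
      using AB by simp
    show "u - v \<in> U" if "u \<in> A \<inter> B" and "v \<in> A \<inter> B" for u v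
      using that AB(4) by auto
  qed
qed

text \<open>
  Two tail values that differ by a vector outside \<open>U\<close> cannot both be \<open>V\<close>-close to the value at
  the index where the tail begins, when differences of vectors in \<open>V\<close> lie in \<open>U\<close>.
\<close>

lemma not_Cauchy_net_jumps:
  assumes "\<not> Cauchy_net I r y"
  obtains V where "open V" and "0 \<in> V"
    and "\<And>k. k \<in> I \<Longrightarrow> \<exists>i\<in>I. (k, i) \<in> r \<and> y i - y k \<notin> V"
proof -
  obtain U where U: "open U" "0 \<in> U"
    and far: "\<And>k. k \<in> I \<Longrightarrow> \<exists>i\<in>I. \<exists>j\<in>I. (k, i) \<in> r \<and> (k, j) \<in> r \<and> y i - y j \<notin> U"
    using assms unfolding Cauchy_net_def by (simp add: Bex_def) metis
  obtain V where V: "open V" "0 \<in> V" "\<And>u v. u \<in> V \<Longrightarrow> v \<in> V \<Longrightarrow> u - v \<in> U"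
    using zero_neighbourhood_diff[OF U] by blast
  show thesis
  proof (rule that[OF V(1,2)])
    fix k assume "k \<in> I"
    then obtain i j where ij: "i \<in> I" "j \<in> I" "(k, i) \<in> r" "(k, j) \<in> r" "y i - y j \<notin> U"
      using far by blast
    have "(y i - y k) - (y j - y k) \<notin> U"
      using ij(5) by simp
    then have "y i - y k \<notin> V \<or> y j - y k \<notin> V"
      using V(3) by blast
    then show "\<exists>i\<in>I. (k, i) \<in> r \<and> y i - y k \<notin> V"
      using ij by blast
  qed
qed

lemma quasi_sigma_KB_imp_quasi_KB:
  assumes "quasi_sigma_KB T"
  shows "quasi_KB TYPE('i) T"
  unfolding quasi_KB_def
proof (intro allI impI, elim conjE)
  fix I :: "'i set" and r and x :: "'i \<Rightarrow> 'a"
  assume dir: "directed_set I r" and inc: "increasing_net I r x"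
    and pos: "\<forall>i\<in>I. 0 \<le> x i" and bdd: "tvs_bounded (x ` I)"
  show "Cauchy_net I r (\<lambda>i. T (x i))"
  proof (rule ccontr)
    assume "\<not> Cauchy_net I r (\<lambda>i. T (x i))"
    then obtain V where V: "open V" "0 \<in> V"
      and jump: "\<And>k. k \<in> I \<Longrightarrow> \<exists>i\<in>I. (k, i) \<in> r \<and> T (x i) - T (x k) \<notin> V"
      by (rule not_Cauchy_net_jumps) blast
    have "\<exists>k. k \<in> I"
      using dir unfolding directed_set_def by blast
    moreover have "\<exists>j. j \<in> I \<and> (i, j) \<in> r \<and> T (x j) - T (x i) \<notin> V" if "i \<in> I" for i
      using jump[OF that] by blast
    ultimately have "\<exists>k. \<forall>n. k n \<in> I \<and>
        (k n, k (Suc n)) \<in> r \<and> T (x (k (Suc n))) - T (x (k n)) \<notin> V"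
      by (rule dependent_nat_choice)
    then obtain k where k: "\<And>n. k n \<in> I"
      and step: "\<And>n. (k n, k (Suc n)) \<in> r \<and> T (x (k (Suc n))) - T (x (k n)) \<notin> V"
      by blast
    have "incseq (\<lambda>n. x (k n))"
    proof (rule incseq_SucI)
      fix n
      show "x (k n) \<le> x (k (Suc n))"
        using inc k step unfolding increasing_net_def by (blast intro: monotone_onD)
    qed
    moreover have "tvs_bounded (range (\<lambda>n. x (k n)))"
      using bdd by (rule tvs_bounded_subset) (use k in blast)
    ultimately have "Cauchy_seq (\<lambda>n. T (x (k n)))"
      using assms pos k unfolding quasi_sigma_KB_def by blast
    then obtain N where "\<forall>m\<ge>N. \<forall>n\<ge>N. T (x (k m)) - T (x (k n)) \<in> V"
      using V unfolding Cauchy_seq_def by blast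
    then have "T (x (k (Suc N))) - T (x (k N)) \<in> V"
      by simp
    then show False
      using step by blast
  qed
qed

lemma quasi_KB_imp_quasi_sigma_KB:
  assumes "infinite (UNIV :: 'i set)" and "quasi_KB TYPE('i) T"
  shows "quasi_sigma_KB T"
  unfolding quasi_sigma_KB_def
proof (intro allI impI, elim conjE)
  fix x :: "nat \<Rightarrow> 'a"
  assume inc: "incseq x" and pos: "\<forall>n. 0 \<le> x n" and bdd: "tvs_bounded (range x)"
  obtain f :: "nat \<Rightarrow> 'i" where f: "inj f"
    using infinite_countable_subset[OF assms(1)] by blast
  \<comment> \<open>The order and the sequence are transported along \<open>f\<close>, so that tails of the net are exactly
    tails of the sequence.\<close>
  define I where "I = range f"
  define r where "r = {(f m, f n) | m n. m \<le> n}"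
  define z where "z = x \<circ> inv f"
  have r_iff: "(f m, f n) \<in> r \<longleftrightarrow> m \<le> n" for m n
    using injD[OF f] unfolding r_def by blast
  have z: "z (f n) = x n" for n
    unfolding z_def using f by simp
  have "r \<subseteq> I \<times> I"
    unfolding r_def I_def by blast
  moreover have "refl_on I r"
    unfolding refl_on_def I_def using r_iff by blast
  moreover have "trans r"
  proof (rule transI)
    fix a b c
    assume ab: "(a, b) \<in> r" and bc: "(b, c) \<in> r"
    obtain l m where lm: "a = f l" "b = f m" "l \<le> m"
      using ab unfolding r_def by blast
    obtain n where n: "c = f n"
      using bc unfolding r_def by blast
    show "(a, c) \<in> r"
      using bc lm n by (simp add: r_iff)
  qed
  ultimately have "preorder_on I r"
    unfolding preorder_on_def by blast
  moreover have "\<exists>k\<in>I. (i, k) \<in> r \<and> (j, k) \<in> r" if ij: "i \<in> I" "j \<in> I" for i j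
  proof -
    obtain m n where "i = f m" "j = f n"
      using ij unfolding I_def by blast
    then have "(i, f (max m n)) \<in> r \<and> (j, f (max m n)) \<in> r"
      by (simp add: r_iff)
    then show ?thesis
      unfolding I_def by blast
  qed
  ultimately have "directed_set I r"
    unfolding directed_set_def I_def by blast
  moreover have "increasing_net I r z"
    unfolding increasing_net_def monotone_on_def I_def
    using inc by (auto simp: z r_iff incseq_def)
  moreover have "\<forall>i\<in>I. 0 \<le> z i"
    using pos by (simp add: I_def z)
  moreover have "z ` I = range x"
    by (simp add: I_def image_image z)
  ultimately have Cauchy: "Cauchy_net I r (\<lambda>i. T (z i))"
    using assms(2) bdd unfolding quasi_KB_def by simp
  show "Cauchy_seq (\<lambda>n. T (x n))"
    unfolding Cauchy_seq_def
  proof (intro allI impI, elim conjE)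
    fix U :: "'b set"
    assume "open U" and "0 \<in> U"
    then obtain k where "k \<in> I"
      and k: "\<forall>i\<in>I. \<forall>j\<in>I. (k, i) \<in> r \<and> (k, j) \<in> r \<longrightarrow> T (z i) - T (z j) \<in> U"
      using Cauchy unfolding Cauchy_net_def by blast
    then obtain N where "k = f N"
      unfolding I_def by blast
    with k have "\<forall>m\<ge>N. \<forall>n\<ge>N. T (x m) - T (x n) \<in> U"
      by (simp add: I_def r_iff z)
    then show "\<exists>N. \<forall>m\<ge>N. \<forall>n\<ge>N. T (x m) - T (x n) \<in> U" ..
  qed
qed

theorem proposition1p2:
  fixes T :: "'a::locally_solid_lattice \<Rightarrow> 'b::topological_vector_space"
  assumes "linear T"
    and "infinite (UNIV :: 'i set)"
  shows "quasi_KB TYPE('i) T \<longleftrightarrow> quasi_sigma_KB T"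
  using quasi_KB_imp_quasi_sigma_KB[OF assms(2)] quasi_sigma_KB_imp_quasi_KB by blast

end
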